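(* Fix an integer $t\geq 2$, a rule assigning to any two finite families $A,B$ of objects a bipartite graph $G_{A,B}$ with parts $A$ and $B$ (e.g., the bipartite intersection graph), and two hereditary classes $\mathcal{F},\mathcal{F}'$ of finite families of objects. With $f,f^*,g$ as defined in the context, for all $m,n$, $$ g(m,n) \leq \min_{1 \leq k \leq m-1}\; \min_{1 \leq \ell \leq n-1} \Big((k-1)n+(\ell-1) m + g\big((t-1)f(m,k),\,(t-1)f^*(n,\ell)\big)\Big). $$
   Context: A hypergraph $H=(V,\mathcal{E})$ on $N$ vertices, $\epsilon\in(0,1)$ and $t\ge1$: an $\epsilon$-$t$-net is a set $S\subset\binom{V}{t}$ of $t$-tuples of vertices such that every hyperedge $e\in\mathcal{E}$ with $|e|\geq \epsilon N$ contains at least one $t$-tuple of $S$. For a bipartite graph $G=G_{A,B}$, the primal hypergraph is $H_G=(A,\{N(b):b\in B\})$ and the dual hypergraph is $H_G^*=(B,\{N(a):a\in A\})$, where $N(\cdot)$ denotes neighborhood. For $|A|=m$, $|B|=n$, $f_G(m,k)$ is the minimum size of a $\frac{k}{m}$-$t$-net of $H_G$ and $f^*_G(n,\ell)$ the minimum size of an $\frac{\ell}{n}$-$t$-net of $H^*_G$. A class $\mathcal{F}$ of families is hereditary if $A\in\mathcal{F}$ and $A'\subset A$ imply $A'\in\mathcal{F}$. Define $f(m,k)$ and $f^*(n,\ell)$ as the maxima of $f_G(m,k)$ and $f^*_G(n,\ell)$ over all $G=G_{A,B}$ with $A\in\mathcal{F}$, $B\in\mathcal{F}'$, $|A|=m$,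 $|B|=n$, and $g(m,n)$ as the maximum number of edges of a $K_{t,t}$-free such $G_{A,B}$ (i.e., with no complete bipartite subgraph having $t$ vertices on each side).
   Formalization: The rule is assumed to give induced subgraphs on subfamilies; the arguments of g on the right are swapped to ((t-1)f*(n,l), (t-1)f(m,k)) and capped at m and n (also when no net exists), since the printed formula fails otherwise. *)

theory Defs
  imports Complex_Main "HOL-Library.Extended_Nat" "HOL-Library.Ramsey"
begin

definition is_net :: "nat \<Rightarrow> real \<Rightarrow> 'v set \<Rightarrow> 'v set set \<Rightarrow> 'v set set \<Rightarrow> bool" where
  "is_net t \<epsilon> V \<E> S \<longleftrightarrow>
     S \<subseteq> nsets V t \<and>
     (\<forall>e\<in>\<E>. real (card e) \<ge> \<epsilon> * real (card V) \<longrightarrow> (\<exists>T\<in>S. T \<subseteq> e))"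

text \<open>A net need not exist: a hyperedge with at least \<open>\<epsilon> N\<close> but fewer than \<open>t\<close> vertices
  contains no \<open>t\<close>-tuple at all. The minimum size is then \<open>\<infinity>\<close>.\<close>

definition net_number :: "nat \<Rightarrow> real \<Rightarrow> 'v set \<Rightarrow> 'v set set \<Rightarrow> enat" where
  "net_number t \<epsilon> V \<E> = (INF S \<in> {S. is_net t \<epsilon> V \<E> S}. enat (card S))"

text \<open>A bipartite graph with parts \<open>A\<close> and \<open>B\<close> is given by its set of edges
  \<open>E \<subseteq> A \<times> B\<close>; the ordered pairs keep the two parts apart even if
  \<open>A\<close> and \<open>B\<close> have objects in common.\<close>

definition primal_edges :: "'a set \<Rightarrow> 'b set \<Rightarrow> ('a \<times> 'b) set \<Rightarrow> 'a set set" where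
  "primal_edges A B E = (\<lambda>b. {a \<in> A. (a, b) \<in> E}) ` B"

definition dual_edges :: "'a set \<Rightarrow> 'b set \<Rightarrow> ('a \<times> 'b) set \<Rightarrow> 'b set set" where
  "dual_edges A B E = (\<lambda>a. {b \<in> B. (a, b) \<in> E}) ` A"

definition biclique_free :: "nat \<Rightarrow> 'a set \<Rightarrow> 'b set \<Rightarrow> ('a \<times> 'b) set \<Rightarrow> bool" where
  "biclique_free t A B E \<longleftrightarrow> \<not> (\<exists>P\<in>nsets A t. \<exists>Q\<in>nsets B t. P \<times> Q \<subseteq> E)"

definition hereditary :: "'a set set \<Rightarrow> bool" where
  "hereditary F \<longleftrightarrow> (\<forall>A\<in>F. \<forall>A'. A' \<subseteq> A \<longrightarrow> A' \<in> F)"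

text \<open>As for intersection graphs, whether two objects are adjacent does not depend on the other
  members of the two families: the graph of subfamilies is the induced subgraph.\<close>

definition graph_rule :: "('a set \<Rightarrow> 'b set \<Rightarrow> ('a \<times> 'b) set) \<Rightarrow> bool" where
  "graph_rule G \<longleftrightarrow>
     (\<forall>A B. finite A \<longrightarrow> finite B \<longrightarrow> G A B \<subseteq> A \<times> B) \<and>
     (\<forall>A B A' B'. finite A \<longrightarrow> finite B \<longrightarrow> A' \<subseteq> A \<longrightarrow> B' \<subseteq> B \<longrightarrow>
        G A' B' = G A B \<inter> (A' \<times> B'))"

definition pairs_of_size :: "'a set set \<Rightarrow> 'b set set \<Rightarrow> nat \<Rightarrow> nat \<Rightarrow> ('a set \<times> 'b set) set" where
  "pairs_of_size F F' m n = {(A, B). A \<in> F \<and> B \<in> F' \<and> card A = m \<and> card B = n}"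

text \<open>The maxima \<open>f(m,k)\<close> and \<open>f\<^sup>*(n,\<ell>)\<close> are over graphs with \<open>|A| = m\<close> and \<open>|B| = n\<close>,
  so both sizes are parameters. Only finitely many values occur, so the suprema are maxima
  (and \<open>0\<close> if there is no pair of families of these sizes).\<close>

definition f_primal ::
  "nat \<Rightarrow> ('a set \<Rightarrow> 'b set \<Rightarrow> ('a \<times> 'b) set) \<Rightarrow> 'a set set \<Rightarrow> 'b set set \<Rightarrow>
   nat \<Rightarrow> nat \<Rightarrow> nat \<Rightarrow> enat" where
  "f_primal t G F F' m n k =
     (SUP (A, B) \<in> pairs_of_size F F' m n.
        net_number t (real k / real m) A (primal_edges A B (G A B)))"

definition f_dual ::
  "nat \<Rightarrow> ('a set \<Rightarrow> 'b set \<Rightarrow> ('a \<times> 'b) set) \<Rightarrow> 'a set set \<Rightarrow> 'b set set \<Rightarrow>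
   nat \<Rightarrow> nat \<Rightarrow> nat \<Rightarrow> enat" where
  "f_dual t G F F' m n l =
     (SUP (A, B) \<in> pairs_of_size F F' m n.
        net_number t (real l / real n) B (dual_edges A B (G A B)))"

text \<open>On \<^typ>\<open>nat\<close>, \<^const>\<open>Sup\<close> is the maximum of a finite nonempty set, and \<open>0\<close> for the empty set.\<close>

definition g_max ::
  "nat \<Rightarrow> ('a set \<Rightarrow> 'b set \<Rightarrow> ('a \<times> 'b) set) \<Rightarrow> 'a set set \<Rightarrow> 'b set set \<Rightarrow>
   nat \<Rightarrow> nat \<Rightarrow> nat" where
  "g_max t G F F' m n =
     Sup {card (G A B) | A B. (A, B) \<in> pairs_of_size F F' m n \<and> biclique_free t A B (G A B)}"

text \<open>The number \<open>x\<close> as a bound on the size of a subfamily of a family of size \<open>m\<close>; no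
  bound beyond \<open>m\<close> itself if \<open>x\<close> exceeds \<open>m\<close> or is infinite.\<close>

definition cap :: "nat \<Rightarrow> enat \<Rightarrow> nat" where
  "cap m x = the_enat (min (enat m) x)"

end

theory Submission imports Defs begin

text \<open>Call a vertex heavy if its degree is at least \<open>k\<close> (in \<open>B\<close>) or \<open>\<ell>\<close> (in \<open>A\<close>). The neighbourhood of
  every heavy \<open>b\<close> contains a \<open>t\<close>-tuple of the primal net, and by \<open>K\<^sub>t\<^sub>,\<^sub>t\<close>-freeness each \<open>t\<close>-tuple has at
  most \<open>t - 1\<close> common neighbours; so there are at most \<open>(t - 1) f(m,k)\<close> heavy vertices in \<open>B\<close>, and
  dually in \<open>A\<close>. Edges with a light endpoint number at most \<open>(k - 1) n + (\<ell> - 1) m\<close>; the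
  remaining ones lie in the graph induced on the heavy vertices, which is again \<open>K\<^sub>t\<^sub>,\<^sub>t\<close>-free.\<close>

text \<open>Exchanging the parts turns the dual hypergraph into the primal one, so the bounds on
  heavy vertices and light edges are proved once and applied to both \<open>E\<close> and its
  converse.\<close>

lemma biclique_free_converse:
  assumes "biclique_free t A B E"
  shows "biclique_free t B A (E\<inverse>)"
proof -
  have "Q \<times> P \<subseteq> E" if "P \<times> Q \<subseteq> E\<inverse>" for P Q
    using that by auto
  then show ?thesis using assms unfolding biclique_free_def by blast
qed

lemma primal_edges_converse: "primal_edges B A (E\<inverse>) = dual_edges A B E"
  by (simp add: primal_edges_def dual_edges_def)

lemma card_common_neighbours_le:
  assumes "finite B" "biclique_free t A B E" "T \<in> nsets A t"
  shows "card {b \<in> B. T \<times> {b} \<subseteq> E} \<le> t - 1"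
proof (rule ccontr)
  assume "\<not> ?thesis"
  then have "t \<le> card {b \<in> B. T \<times> {b} \<subseteq> E}" by linarith
  then obtain Q where Q: "Q \<subseteq> {b \<in> B. T \<times> {b} \<subseteq> E}" "card Q = t" "finite Q"
    by (rule obtain_subset_with_card_n)
  then have "Q \<in> nsets B t" "T \<times> Q \<subseteq> E"
    by (auto simp: nsets_def)
  with assms show False unfolding biclique_free_def by blast
qed

text \<open>Each heavy \<open>b\<close> is a common neighbour of some tuple in \<open>S\<close>; a
  union bound over \<open>S\<close> finishes.\<close>

lemma card_heavy_le_card_net:
  assumes "finite A" "finite B" "biclique_free t A B E"
    and net: "is_net t \<epsilon> A (primal_edges A B E) S"
  shows "card {b \<in> B. \<epsilon> * real (card A) \<le> real (card {a \<in> A. (a, b) \<in> E})} \<le> (t - 1) * card S"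
    (is "card ?H \<le> _")
proof -
  have S: "S \<subseteq> nsets A t" using net by (simp add: is_net_def)
  have "finite S" using S finite_imp_finite_nsets[OF \<open>finite A\<close>] by (rule finite_subset)
  have "?H \<subseteq> (\<Union>T\<in>S. {b \<in> B. T \<times> {b} \<subseteq> E})"
  proof
    fix b assume b: "b \<in> ?H"
    then have "{a \<in> A. (a, b) \<in> E} \<in> primal_edges A B E"
      by (auto simp: primal_edges_def)
    with b net obtain T where "T \<in> S" "T \<subseteq> {a \<in> A. (a, b) \<in> E}"
      unfolding is_net_def by blast
    with b show "b \<in> (\<Union>T\<in>S. {b \<in> B. T \<times> {b} \<subseteq> E})" by blast
  qed
  then have "card ?H \<le> card (\<Union>T\<in>S. {b \<in> B. T \<times> {b} \<subseteq> E})"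
    using \<open>finite S\<close> \<open>finite B\<close> by (intro card_mono) auto
  also have "\<dots> \<le> (\<Sum>T\<in>S. card {b \<in> B. T \<times> {b} \<subseteq> E})"
    using \<open>finite S\<close> by (rule card_UN_le)
  also have "\<dots> \<le> (\<Sum>T\<in>S. t - 1)"
    using S card_common_neighbours_le[OF assms(2,3)] by (intro sum_mono) blast
  finally show ?thesis by (simp add: mult.commute)
qed

lemma card_heavy_le_net_number:
  assumes "t \<ge> 2" "finite A" "A \<noteq> {}" "finite B" "biclique_free t A B E"
  shows "enat (card {b \<in> B. k \<le> card {a \<in> A. (a, b) \<in> E}})
    \<le> enat (t - 1) * net_number t (real k / real (card A)) A (primal_edges A B E)"
    (is "enat ?h \<le> _ * net_number t ?\<epsilon> A ?\<E>")
proof (cases "\<exists>S. is_net t ?\<epsilon> A ?\<E> S")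
  case True
  then obtain S\<^sub>0 where "is_net t ?\<epsilon> A ?\<E> S\<^sub>0" ..
  \<comment> \<open>As \<open>enat\<close> is well-ordered, the infimum is attained by an actual
    net.\<close>
  then have "net_number t ?\<epsilon> A ?\<E> \<in> (\<lambda>S. enat (card S)) ` {S. is_net t ?\<epsilon> A ?\<E> S}"
    unfolding net_number_def by (intro wellorder_InfI[of "enat (card S\<^sub>0)"]) simp
  then obtain S where S: "is_net t ?\<epsilon> A ?\<E> S" "net_number t ?\<epsilon> A ?\<E> = enat (card S)" by auto
  \<comment> \<open>Since \<open>A\<close> is nonempty, the threshold
    \<open>?\<epsilon> * card A\<close> is exactly \<open>k\<close>.\<close>
  then show ?thesis
    using card_heavy_le_card_net[OF assms(2,4,5) S(1)] assms(2,3) by simp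
next
  case False
  then have "net_number t ?\<epsilon> A ?\<E> = \<infinity>"
    by (simp add: net_number_def top_enat_def)
  \<comment> \<open>Here \<open>t \<ge> 2\<close> matters: \<open>t - 1\<close> is nonzero, so its
    product with infinity is infinity and not \<open>0\<close>.\<close>
  then show ?thesis using \<open>t \<ge> 2\<close> by (simp add: enat_0_iff imult_is_infinity)
qed

lemma card_light_edges_le:
  assumes "finite A" "finite B" "E \<subseteq> A \<times> B" "k \<ge> 1"
  shows "card {(a, b) \<in> E. card {a \<in> A. (a, b) \<in> E} < k} \<le> (k - 1) * card B"
    (is "card ?L \<le> _")
proof -
  let ?N = "\<lambda>b. {a \<in> A. (a, b) \<in> E}"
  let ?B = "{b \<in> B. card (?N b) < k}"
  have "?L \<subseteq> (\<Union>b\<in>?B. ?N b \<times> {b})" using assms(3) by auto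
  then have "card ?L \<le> card (\<Union>b\<in>?B. ?N b \<times> {b})"
    using assms by (intro card_mono) auto
  also have "\<dots> \<le> (\<Sum>b\<in>?B. card (?N b \<times> {b}))"
    using assms by (intro card_UN_le) auto
  also have "\<dots> \<le> (\<Sum>b\<in>?B. k - 1)"
    using assms by (intro sum_mono) (auto simp: card_cartesian_product)
  also have "\<dots> \<le> (k - 1) * card B"
    using assms by (simp add: card_mono)
  finally show ?thesis .
qed

text \<open>Capping at \<open>m\<close> loses nothing, since the heavy vertices already lie in a
  part of size \<open>m\<close>.\<close>

lemma le_cap:
  assumes "x \<le> m" "enat x \<le> y"
  shows "x \<le> cap m y"
  using assms by (cases y) (auto simp: cap_def min_def)

lemma cap_le: "cap m x \<le> m"
  by (cases x) (auto simp: cap_def min_def)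

text \<open>\<open>g_max\<close> refers to exact sizes and need not be monotone: it is
  \<open>0\<close> once no families are that large. Heavy sets are therefore padded inside the given
  part to the exact size required.\<close>

lemma obtain_superset_with_card:
  assumes "finite A" "H \<subseteq> A" "card H \<le> c" "c \<le> card A"
  obtains A' where "H \<subseteq> A'" "A' \<subseteq> A" "card A' = c"
  using exists_subset_between[OF assms(3,4,2,1)] by blast

lemma graph_rule_induced:
  assumes "graph_rule G" "finite A" "finite B" "A' \<subseteq> A" "B' \<subseteq> B"
  shows "G A' B' = G A B \<inter> (A' \<times> B')"
  using conjunct2[OF assms(1)[unfolded graph_rule_def], rule_format, OF assms(2-5)] .

lemma card_le_g_max:
  assumes "graph_rule G" "\<forall>A\<in>F. finite A" "\<forall>B\<in>F'. finite B"
    and "A \<in> F" "B \<in> F'" "card A = m" "card B = n" "biclique_free t A B (G A B)"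
  shows "card (G A B) \<le> g_max t G F F' m n"
  unfolding g_max_def
proof (rule cSup_upper)
  \<comment> \<open>\<open>Sup\<close> on \<open>nat\<close> is an upper bound only for bounded
    sets; \<open>m * n\<close> serves as the bound.\<close>
  have "card (G A B) \<le> m * n" if "A \<in> F" "B \<in> F'" "card A = m" "card B = n" for A B
  proof -
    have "finite A" "finite B" using that assms(2,3) by auto
    moreover from this have "G A B \<subseteq> A \<times> B" using assms(1) unfolding graph_rule_def by blast
    ultimately show ?thesis
      using that card_mono[of "A \<times> B" "G A B"] by (simp add: card_cartesian_product)
  qed
  then show "bdd_above {card (G A B) | A B.
      (A, B) \<in> pairs_of_size F F' m n \<and> biclique_free t A B (G A B)}"
    by (intro bdd_aboveI[of _ "m * n"]) (auto simp: pairs_of_size_def)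
qed (use assms(4-8) in \<open>auto simp: pairs_of_size_def\<close>)

lemma g_max_le:
  assumes "\<And>A B. A \<in> F \<Longrightarrow> B \<in> F' \<Longrightarrow> card A = m \<Longrightarrow> card B = n \<Longrightarrow>
    biclique_free t A B (G A B) \<Longrightarrow> card (G A B) \<le> x"
  shows "g_max t G F F' m n \<le> x"
proof (cases "{card (G A B) | A B.
    (A, B) \<in> pairs_of_size F F' m n \<and> biclique_free t A B (G A B)} = {}")
  case True
  show ?thesis unfolding g_max_def True by simp
next
  case False
  then show ?thesis unfolding g_max_def
    using assms by (intro cSup_least) (auto simp: pairs_of_size_def)
qed

text \<open>Primal nets consist of tuples from \<open>A\<close> but bound the heavy vertices in
  \<open>B\<close>; hence \<open>f_primal\<close> governs the second argument of
  \<open>g_max\<close> and \<open>f_dual\<close> the first.\<close>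

lemma card_graph_le:
  fixes G :: "'a set \<Rightarrow> 'b set \<Rightarrow> ('a \<times> 'b) set"
  assumes "t \<ge> 2" and G: "graph_rule G"
    and fin: "\<forall>A\<in>F. finite A" "\<forall>B\<in>F'. finite B"
    and her: "hereditary F" "hereditary F'"
    and AB: "A \<in> F" "B \<in> F'" "card A = m" "card B = n"
    and free: "biclique_free t A B (G A B)"
    and pos: "m > 0" "n > 0" "k \<ge> 1" "l \<ge> 1"
  shows "card (G A B) \<le> (k - 1) * n + (l - 1) * m +
    g_max t G F F'
      (cap m (enat (t - 1) * f_dual t G F F' m n l))
      (cap n (enat (t - 1) * f_primal t G F F' m n k))"
    (is "_ \<le> _ + g_max t G F F' ?m' ?n'")
proof -
  let ?E = "G A B"
  define HA where "HA = {a \<in> A. l \<le> card {b \<in> B. (a, b) \<in> ?E}}"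
  define HB where "HB = {b \<in> B. k \<le> card {a \<in> A. (a, b) \<in> ?E}}"
  have finA: "finite A" "A \<noteq> {}" and finB: "finite B" "B \<noteq> {}"
    using AB fin pos by auto
  have E: "?E \<subseteq> A \<times> B" using G finA finB unfolding graph_rule_def by blast
  have pair: "(A, B) \<in> pairs_of_size F F' m n" using AB by (simp add: pairs_of_size_def)

  have "enat (card HB) \<le> enat (t - 1) * net_number t (real k / real m) A (primal_edges A B ?E)"
    using card_heavy_le_net_number[OF \<open>t \<ge> 2\<close> finA finB(1) free, of k] AB
    by (simp add: HB_def)
  also have "\<dots> \<le> enat (t - 1) * f_primal t G F F' m n k"
    unfolding f_primal_def by (intro mult_left_mono SUP_upper2[OF pair]) auto
  finally have "card HB \<le> ?n'"
    using finB AB by (intro le_cap) (auto simp: HB_def intro: card_mono)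
  then obtain B' where B': "HB \<subseteq> B'" "B' \<subseteq> B" "card B' = ?n'"
    using obtain_superset_with_card[of B HB ?n'] finB cap_le AB by (auto simp: HB_def)

  have "enat (card HA) \<le> enat (t - 1) * net_number t (real l / real n) B (dual_edges A B ?E)"
    using card_heavy_le_net_number[OF \<open>t \<ge> 2\<close> finB finA(1) biclique_free_converse[OF free], of l] AB
    by (simp add: HA_def primal_edges_converse)
  also have "\<dots> \<le> enat (t - 1) * f_dual t G F F' m n l"
    unfolding f_dual_def by (intro mult_left_mono SUP_upper2[OF pair]) auto
  finally have "card HA \<le> ?m'"
    using finA AB by (intro le_cap) (auto simp: HA_def intro: card_mono)
  then obtain A' where A': "HA \<subseteq> A'" "A' \<subseteq> A" "card A' = ?m'"
    using obtain_superset_with_card[of A HA ?m'] finA cap_le AB by (auto simp: HA_def)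

  have E': "G A' B' = ?E \<inter> (A' \<times> B')"
    using G finA(1) finB(1) A'(2) B'(2) by (rule graph_rule_induced)
  have "biclique_free t A' B' (G A' B')"
    using free nsets_mono[OF A'(2), of t] nsets_mono[OF B'(2), of t]
    unfolding biclique_free_def E' by (meson le_infE subsetD)
  moreover have "A' \<in> F" "B' \<in> F'" using her AB(1,2) A'(2) B'(2) unfolding hereditary_def by simp_all
  ultimately have heavy: "card (G A' B') \<le> g_max t G F F' ?m' ?n'"
    using A' B' by (intro card_le_g_max[OF G fin]) auto

  define LB where "LB = {(a, b) \<in> ?E. card {a \<in> A. (a, b) \<in> ?E} < k}"
  \<comment> \<open>Pairs are reversed so that the light-edge bound applies with the parts
    exchanged; \<open>LA\<inverse>\<close> restores the orientation.\<close>
  define LA where "LA = {(b, a) \<in> ?E\<inverse>. card {b \<in> B. (b, a) \<in> ?E\<inverse>} < l}"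
  have LB: "card LB \<le> (k - 1) * n"
    using card_light_edges_le[OF finA(1) finB(1) E \<open>k \<ge> 1\<close>] AB by (simp add: LB_def)
  have "?E\<inverse> \<subseteq> B \<times> A" using E by auto
  from card_light_edges_le[OF finB(1) finA(1) this \<open>l \<ge> 1\<close>]
  have LA: "card (LA\<inverse>) \<le> (l - 1) * m" using AB by (simp add: LA_def)
  \<comment> \<open>An edge in neither light set has both ends heavy, so it lies in
    \<open>HA \<times> HB\<close> and hence in \<open>A' \<times> B'\<close>.\<close>
  have "?E \<subseteq> LB \<union> LA\<inverse> \<union> G A' B'"
    using E A'(1) B'(1) unfolding E' by (auto simp: LA_def LB_def HA_def HB_def not_less)
  moreover have "LB \<union> LA\<inverse> \<union> G A' B' \<subseteq> ?E"
    unfolding E' by (auto simp: LA_def LB_def)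
  ultimately have "?E = LB \<union> LA\<inverse> \<union> G A' B'" by blast
  then have "card ?E = card (LB \<union> LA\<inverse> \<union> G A' B')" by simp
  also have "\<dots> \<le> card LB + card (LA\<inverse>) + card (G A' B')"
    by (meson add_le_mono1 card_Un_le le_trans)
  finally show ?thesis using LA LB heavy by linarith
qed

theorem theorem6:
  fixes t m n :: nat
    and G :: "'a set \<Rightarrow> 'a set \<Rightarrow> ('a \<times> 'a) set"
    and F F' :: "'a set set"
  assumes "t \<ge> 2"
    and "graph_rule G"
    and "\<forall>A\<in>F. finite A" and "\<forall>B\<in>F'. finite B"
    and "hereditary F" and "hereditary F'"
  shows "enat (g_max t G F F' m n) \<le>
    (INF k\<in>{1..m - 1}. INF l\<in>{1..n - 1}.
       enat ((k - 1) * n + (l - 1) * m +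
         g_max t G F F'
           (cap m (enat (t - 1) * f_dual t G F F' m n l))
           (cap n (enat (t - 1) * f_primal t G F F' m n k))))"
\<comment> \<open>If \<open>m \<le> 1\<close> or \<open>n \<le> 1\<close>, a range of indices is
  empty and the right side is infinity; otherwise both parts are nonempty.\<close>
proof (intro INF_greatest)
  fix k l assume "k \<in> {1..m - 1}" "l \<in> {1..n - 1}"
  then have "m > 0" "n > 0" "k \<ge> 1" "l \<ge> 1" by auto
  then show "enat (g_max t G F F' m n) \<le> enat ((k - 1) * n + (l - 1) * m +
         g_max t G F F'
           (cap m (enat (t - 1) * f_dual t G F F' m n l))
           (cap n (enat (t - 1) * f_primal t G F F' m n k)))"
    unfolding enat_ord_simps by (intro g_max_le card_graph_le[OF assms])
qed

end
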